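(* Let $G$ be a connected graph with cut decomposition $(X,\mathcal{C})$, and let $v$ be a node of $X$. Suppose the survivor is restricted to the component of $v$, i.e. its position is always in $\bigcup_{y\in\Lambda_X(v)}C_y$. Then $\mathrm{load}^*(v)$ lazy zombies, starting from any vertices of $G$, can capture the survivor in at most $\mathrm{time}^*(v)$ rounds.
   Context: Lazy zombies and survivor game on a connected graph $G$: each round, first every lazy zombie either stays at its current vertex $u$ or moves to a neighbour of $u$ lying on a shortest path in $G$ from $u$ to the survivor's current vertex; then the survivor stays or moves to an adjacent vertex; full information; capture means a lazy zombie occupies the survivor's vertex. $\delta(G)$ is the diameter of $G$. A cut decomposition of $G$ is a pair $(X,\mathcal{C})$ where $X$ is a rooted tree and $\mathcal{C}=\{C_x\subseteq V(G)\}_{x\in V(X)}$ such that: every vertex lies in a unique $C_x$; for every edge $uv$ there are $x,y$ with $u\in C_x$, $v\in C_y$ and $x$ an ancestor of $y$ (a node is its own ancestor); for every non-leaf $y$, $C_y$ is a cut set of $G[\bigcup_{x\in\Lambda_X(y)}C_x]$, $\Lambda_X(y)$ being the subtree of $X$ rooted at $y$. For $S\subseteq V(G)$, $\theta(S)$ is the clique cover number of $G[S]$. Define $\mathrm{load}^*(v)=\theta(C_v)$ if $v$ is a leaf and $\mathrm{load}^*(v)=\theta(C_v)+\max_w\mathrm{load}^*(w)$ over children $w$ otherwise; $\mathrm{time}^*(v)=\theta(C_v)\delta(G)+1$ if $v$ is a leaf and $\mathrm{time}^*(v)=(\theta(C_v)\delta(G)+1)\max_w\mathrm{time}^*(w)$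 otherwise. *)

theory Defs
  imports "Graph_Theory.Graph_Theory"
begin

subsection \<open>Graphs\<close>

text \<open>
  A finite simple graph is a finite loop-free symmetric digraph without multiple arcs, i.e. the
  library locale \<^verbatim>\<open>graph\<close>. An edge \<open>uv\<close> is the pair of arcs \<open>u \<rightarrow> v\<close> and \<open>v \<rightarrow> u\<close>.
\<close>

definition shortest_path :: "('a,'b) pre_digraph \<Rightarrow> 'a \<Rightarrow> 'b list \<Rightarrow> 'a \<Rightarrow> bool" where
  "shortest_path G u p v \<longleftrightarrow>
     pre_digraph.apath G u p v \<and> (\<forall>q. pre_digraph.apath G u q v \<longrightarrow> length p \<le> length q)"

definition graph_dist :: "('a,'b) pre_digraph \<Rightarrow> 'a \<Rightarrow> 'a \<Rightarrow> nat" where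
  "graph_dist G u v = (LEAST n. \<exists>p. pre_digraph.apath G u p v \<and> length p = n)"

definition graph_diameter :: "('a,'b) pre_digraph \<Rightarrow> nat" where
  "graph_diameter G = Max {graph_dist G u v |u v. u \<in> verts G \<and> v \<in> verts G}"

definition clique :: "('a,'b) pre_digraph \<Rightarrow> 'a set \<Rightarrow> bool" where
  "clique G K \<longleftrightarrow> K \<subseteq> verts G \<and> (\<forall>u\<in>K. \<forall>v\<in>K. u \<noteq> v \<longrightarrow> u \<rightarrow>\<^bsub>G\<^esub> v)"

definition clique_cover_number :: "('a,'b) pre_digraph \<Rightarrow> nat" where
  "clique_cover_number G =
     (LEAST k. \<exists>P. finite P \<and> card P = k \<and> (\<forall>K\<in>P. clique G K) \<and> \<Union>P = verts G)"

text \<open>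
  The library counts the graph without vertices as not connected; a cut set must leave at least
  two components, so that case is excluded explicitly.
\<close>

definition cut_set :: "('a,'b) pre_digraph \<Rightarrow> 'a set \<Rightarrow> bool" where
  "cut_set G S \<longleftrightarrow> S \<subseteq> verts G \<and> verts G - S \<noteq> {} \<and>
     \<not> Digraph_Component.connected (G \<restriction> (verts G - S))"


subsection \<open>Rooted trees and cut decompositions\<close>

text \<open>Arcs of a rooted tree point from a node to its children.\<close>

locale rooted_tree = fin_digraph X for X :: "('n,'e) pre_digraph" (structure) +
  fixes r :: 'n
  assumes root_in_verts: "r \<in> verts X"
    and unique_awalk: "x \<in> verts X \<Longrightarrow> \<exists>!p. awalk r p x"

definition children :: "('n,'e) pre_digraph \<Rightarrow> 'n \<Rightarrow> 'n set" where
  "children X v = {w. v \<rightarrow>\<^bsub>X\<^esub> w}"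

definition is_leaf :: "('n,'e) pre_digraph \<Rightarrow> 'n \<Rightarrow> bool" where
  "is_leaf X v \<longleftrightarrow> children X v = {}"

definition subtree_nodes :: "('n,'e) pre_digraph \<Rightarrow> 'n \<Rightarrow> 'n set" where
  "subtree_nodes X v = {x. v \<rightarrow>\<^sup>*\<^bsub>X\<^esub> x}"

definition subtree_bags :: "('n,'e) pre_digraph \<Rightarrow> ('n \<Rightarrow> 'a set) \<Rightarrow> 'n \<Rightarrow> 'a set" where
  "subtree_bags X C v = (\<Union>x\<in>subtree_nodes X v. C x)"

text \<open>
  Edges are unordered, so in the second condition either endpoint may be the one that lies in the
  bag of the ancestor.
\<close>

definition cut_decomposition ::
  "('a,'b) pre_digraph \<Rightarrow> ('n,'e) pre_digraph \<Rightarrow> 'n \<Rightarrow> ('n \<Rightarrow> 'a set) \<Rightarrow> bool" where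
  "cut_decomposition G X r C \<longleftrightarrow>
     rooted_tree X r \<and>
     (\<forall>x\<in>verts X. C x \<subseteq> verts G) \<and>
     (\<forall>u\<in>verts G. \<exists>!x. x \<in> verts X \<and> u \<in> C x) \<and>
     (\<forall>u v. u \<rightarrow>\<^bsub>G\<^esub> v \<longrightarrow>
        (\<exists>x\<in>verts X. \<exists>y\<in>verts X. x \<rightarrow>\<^sup>*\<^bsub>X\<^esub> y \<and>
           (u \<in> C x \<and> v \<in> C y \<or> v \<in> C x \<and> u \<in> C y))) \<and>
     (\<forall>y\<in>verts X. \<not> is_leaf X y \<longrightarrow> cut_set (G \<restriction> subtree_bags X C y) (C y))"

context rooted_tree
begin

lemma acyclic_arcs_ends: "acyclic (arcs_ends X)"
proof (rule acyclicI, intro allI notI)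
  fix x assume "x \<rightarrow>\<^sup>+\<^bsub>X\<^esub> x"
  then obtain c where c: "awalk x c x" "c \<noteq> []"
    unfolding reachable1_awalk by blast
  from c(1) have "x \<in> verts X" by (rule awalk_hd_in_verts)
  then have "\<exists>!p. awalk r p x" by (rule unique_awalk)
  then obtain p where p: "awalk r p x" "\<And>q. awalk r q x \<Longrightarrow> q = p"
    by (elim ex1E) blast
  have "awalk r (p @ c) x" using p(1) c(1) by (rule awalk_appendI)
  then have "p @ c = p" by (rule p(2))
  with c(2) show False by simp
qed

lemma wf_child: "wf {(w, v). w \<in> children X v}"
proof -
  have "finite (arcs_ends X)" by (simp add: arcs_ends_def)
  then have "wf ((arcs_ends X)\<inverse>)"
    using acyclic_arcs_ends by (rule finite_acyclic_wf_converse)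
  moreover have "(arcs_ends X)\<inverse> = {(w, v). w \<in> children X v}"
    by (auto simp: children_def)
  ultimately show ?thesis by simp
qed

context
  fixes G :: "('a,'b) pre_digraph" and C :: "'n \<Rightarrow> 'a set"
begin

function load_star :: "'n \<Rightarrow> nat" where
  "load_star v =
     (if is_leaf X v then clique_cover_number (G \<restriction> C v)
      else clique_cover_number (G \<restriction> C v) + Max (load_star ` children X v))"
  by pat_completeness simp
termination by (relation "{(w, v). w \<in> children X v}") (rule wf_child, simp)

function time_star :: "'n \<Rightarrow> nat" where
  "time_star v =
     (if is_leaf X v then clique_cover_number (G \<restriction> C v) * graph_diameter G + 1
      else (clique_cover_number (G \<restriction> C v) * graph_diameter G + 1)
             * Max (time_star ` children X v))"
  by pat_completeness simp
termination by (relation "{(w, v). w \<in> children X v}") (rule wf_child, simp)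

declare load_star.simps [simp del] time_star.simps [simp del]

end

end


subsection \<open>The lazy zombies and survivor game\<close>

text \<open>
  Round \<open>n + 1\<close> takes the survivor from \<open>s n\<close> to \<open>s (n + 1)\<close> and the zombies, who move first, from
  \<open>Z n\<close> to \<open>Z (n + 1)\<close>; \<open>Z n i\<close> is the vertex of the \<open>i\<close>-th of \<open>k\<close> zombies.
\<close>

definition lazy_zombie_move :: "('a,'b) pre_digraph \<Rightarrow> 'a \<Rightarrow> 'a \<Rightarrow> 'a \<Rightarrow> bool" where
  "lazy_zombie_move G s u w \<longleftrightarrow>
     w = u \<or>
     u \<rightarrow>\<^bsub>G\<^esub> w \<and> (\<exists>p. shortest_path G u p s \<and> w \<in> set (pre_digraph.awalk_verts G u p))"

definition survivor_play :: "('a,'b) pre_digraph \<Rightarrow> (nat \<Rightarrow> 'a) \<Rightarrow> bool" where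
  "survivor_play G s \<longleftrightarrow>
     s 0 \<in> verts G \<and> (\<forall>n. s (Suc n) = s n \<or> s n \<rightarrow>\<^bsub>G\<^esub> s (Suc n))"

text \<open>
  A strategy maps the positions \<open>s 0, \<dots>, s n\<close> of the survivor so far to the next positions of the
  zombies. With the starting positions fixed, this list determines the whole history of the game.
\<close>

type_synonym 'a zombie_strategy = "'a list \<Rightarrow> nat \<Rightarrow> 'a"

fun zombie_play ::
  "(nat \<Rightarrow> 'a) \<Rightarrow> 'a zombie_strategy \<Rightarrow> (nat \<Rightarrow> 'a) \<Rightarrow> nat \<Rightarrow> nat \<Rightarrow> 'a" where
  "zombie_play z0 \<sigma> s 0 = z0"
| "zombie_play z0 \<sigma> s (Suc n) = \<sigma> (map s [0..<Suc n])"

text \<open>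
  The first disjunct is capture at the end of a round (or at the start, for \<open>n = 0\<close>), the second
  is capture by a zombie's move in round \<open>n + 1\<close>, before the survivor answers.
\<close>

definition captured_within ::
  "nat \<Rightarrow> (nat \<Rightarrow> nat \<Rightarrow> 'a) \<Rightarrow> (nat \<Rightarrow> 'a) \<Rightarrow> nat \<Rightarrow> bool" where
  "captured_within k Z s t \<longleftrightarrow>
     (\<exists>i<k. (\<exists>n\<le>t. Z n i = s n) \<or> (\<exists>n<t. Z (Suc n) i = s n))"

text \<open>
  \<open>k\<close> lazy zombies starting at \<open>z0\<close> can capture, in at most \<open>t\<close> rounds, a survivor whose position is
  always in \<open>U\<close>.
\<close>

definition lazy_zombies_capture ::
  "('a,'b) pre_digraph \<Rightarrow> 'a set \<Rightarrow> nat \<Rightarrow> (nat \<Rightarrow> 'a) \<Rightarrow> nat \<Rightarrow> bool" where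
  "lazy_zombies_capture G U k z0 t \<longleftrightarrow>
     (\<exists>\<sigma>. \<forall>s. survivor_play G s \<and> (\<forall>n. s n \<in> U) \<longrightarrow>
        (\<forall>n. \<forall>i<k. lazy_zombie_move G (s n) (zombie_play z0 \<sigma> s n i) (zombie_play z0 \<sigma> s (Suc n) i)) \<and>
        captured_within k (zombie_play z0 \<sigma> s) s t)"

end

theory Submission
  imports Defs
begin

text \<open>
  Cover the bag \<open>C\<^sub>v\<close> by \<open>\<theta>(C\<^sub>v)\<close> cliques and give each clique \<open>K\<close> its own zombie. Whenever the
  survivor stands in \<open>K\<close>, that zombie can step towards the vertex of \<open>K\<close> nearest to it: either the
  survivor stands on a nearest vertex, or it is exactly one step further away and a shortest path
  to it runs through a nearest vertex. Hence every visit of the survivor to \<open>C\<^sub>v\<close> lowers the sum of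
  the distances of these zombies to their cliques or ends in capture, and at most
  \<open>\<theta>(C\<^sub>v) \<delta>(G)\<close> visits go unpunished. Between two visits the survivor is confined to the
  component of a single child, where the remaining zombies play recursively.
\<close>

section \<open>Distances and shortest paths\<close>

context wf_digraph
begin

text \<open>Cutting a closed subwalk out of a walk that repeats a vertex keeps the ends and shortens
  the walk. The dichotomy also shows that a walk of minimum length is itself a path.\<close>

lemma awalk_apath_or_shorter:
  assumes "awalk u p v"
  shows "apath u p v \<or> (\<exists>q. apath u q v \<and> length q < length p)"
  using assms
proof (induction "length p" arbitrary: p rule: less_induct)
  case less
  show ?case
  proof (cases "distinct (awalk_verts u p)")
    case True
    then show ?thesis using less.prems by (simp add: apath_def)
  next
    case False
    then obtain q c q' w where d: "p = q @ c @ q'" "0 < length c" "awalk u q w" "awalk w q' v"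
      using awalk_not_distinct_decomp[OF less.prems] by blast
    have "awalk u (q @ q') v" "length (q @ q') < length p"
      using d by (auto intro: awalk_appendI)
    then show ?thesis using less.hyps less_trans by blast
  qed
qed

lemma graph_dist_le:
  assumes "awalk u p v"
  shows "graph_dist G u v \<le> length p"
proof -
  obtain q where "apath u q v" "length q \<le> length p"
    using awalk_apath_or_shorter[OF assms] by (auto intro: less_imp_le)
  moreover have "graph_dist G u v \<le> length q"
    unfolding graph_dist_def using calculation(1) by (intro Least_le) blast
  ultimately show ?thesis by simp
qed

lemma graph_dist_awalk:
  assumes "u \<rightarrow>\<^sup>* v"
  obtains p where "awalk u p v" "length p = graph_dist G u v"
proof -
  have "\<exists>n p. apath u p v \<and> length p = n"
    using assms by (simp add: reachable_apath)
  then have "\<exists>p. apath u p v \<and> length p = graph_dist G u v"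
    unfolding graph_dist_def by (rule LeastI_ex)
  then show ?thesis using that by (auto intro: awalkI_apath)
qed

lemma shortest_path_if_length_eq_dist:
  assumes "awalk u p v" "length p = graph_dist G u v"
  shows "shortest_path G u p v"
proof -
  have le: "length p \<le> length q" if "apath u q v" for q
    using graph_dist_le[OF awalkI_apath[OF that]] assms(2) by simp
  then have "apath u p v"
    using awalk_apath_or_shorter[OF assms(1)] by (meson not_le)
  then show ?thesis using le by (simp add: shortest_path_def)
qed

lemma lazy_zombie_move_in_verts:
  assumes "lazy_zombie_move G s u w" "u \<in> verts G"
  shows "w \<in> verts G"
  using assms by (auto simp: lazy_zombie_move_def dest: adj_in_verts)

lemma lazy_zombie_move_first_arc:
  assumes "awalk u (a # p) s" "length (a # p) = graph_dist G u s"
  shows "lazy_zombie_move G s u (head G a)"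
proof -
  have "u \<rightarrow> head G a"
    using assms(1) by (auto simp: awalk_Cons_iff intro: in_arcs_imp_in_arcs_ends)
  moreover have "head G a \<in> set (awalk_verts u (a # p))"
    by (cases p) (use assms(1) in \<open>auto simp: awalk_Cons_iff\<close>)
  ultimately show ?thesis
    using shortest_path_if_length_eq_dist[OF assms] unfolding lazy_zombie_move_def by blast
qed

end

text \<open>The explicit value 0 keeps the diameter bound true for an empty clique, which
  \<open>clique_cover_exists\<close> does not rule out.\<close>

definition dist_to_set :: "('a,'b) pre_digraph \<Rightarrow> 'a set \<Rightarrow> 'a \<Rightarrow> nat" where
  "dist_to_set G K u = (if K = {} then 0 else INF c\<in>K. graph_dist G u c)"

lemma dist_to_set_le: "c \<in> K \<Longrightarrow> dist_to_set G K u \<le> graph_dist G u c"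
  unfolding dist_to_set_def by (auto intro: cINF_lower)

lemma dist_to_set_attained:
  assumes "K \<noteq> {}"
  obtains c where "c \<in> K" "graph_dist G u c = dist_to_set G K u"
  using Inf_nat_def1[of "graph_dist G u ` K"] assms that
  unfolding dist_to_set_def by (metis (no_types, lifting) image_iff image_is_empty)

lemma (in fin_digraph) dist_to_set_le_diameter:
  assumes "K \<subseteq> verts G" "u \<in> verts G"
  shows "dist_to_set G K u \<le> graph_diameter G"
proof (cases "K = {}")
  case True
  then show ?thesis by (simp add: dist_to_set_def)
next
  case False
  then obtain c where c: "c \<in> K" by blast
  let ?D = "{graph_dist G u v |u v. u \<in> verts G \<and> v \<in> verts G}"
  have "?D = (\<lambda>(u, v). graph_dist G u v) ` (verts G \<times> verts G)" by auto
  then have "finite ?D" by simp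
  moreover have "graph_dist G u c \<in> ?D" using c assms by auto
  ultimately have "graph_dist G u c \<le> graph_diameter G"
    unfolding graph_diameter_def by (rule Max_ge)
  then show ?thesis using dist_to_set_le[OF c] le_trans by blast
qed

lemma (in wf_digraph) clique_pursuit:
  assumes "clique G K" "s \<in> K" "strongly_connected G" "u \<in> verts G"
  obtains w where "lazy_zombie_move G s u w"
    "w = s \<or> dist_to_set G K w < dist_to_set G K u"
proof -
  obtain c where c: "c \<in> K" "graph_dist G u c = dist_to_set G K u"
    using assms(2) dist_to_set_attained[of K G u] by blast
  have reach: "u \<rightarrow>\<^sup>* x" if "x \<in> K" for x
    using that assms by (auto simp: clique_def strongly_connected_def)
  \<comment> \<open>Deleting the first arc of a minimum-length walk from \<open>u\<close> into
    \<open>K\<close> leaves a walk into \<open>K\<close> that is one arc shorter.\<close>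
  have closer: "dist_to_set G K (head G a) < dist_to_set G K u"
    if "awalk u (a # p) x" "length (a # p) = dist_to_set G K u" "x \<in> K" for a p x
  proof -
    have "awalk (head G a) p x" using that(1) by (simp add: awalk_Cons_iff)
    then show ?thesis
      using graph_dist_le dist_to_set_le[OF that(3), of G "head G a"] that(2) by fastforce
  qed
  show ?thesis
  proof (cases "graph_dist G u s = dist_to_set G K u")
    case True
    obtain p where p: "awalk u p s" "length p = graph_dist G u s"
      using graph_dist_awalk[OF reach[OF assms(2)]] by blast
    show ?thesis
    proof (cases p)
      case Nil
      then have "u = s" using p(1) by (simp add: awalk_Nil_iff)
      then show ?thesis using that[of s] by (simp add: lazy_zombie_move_def)
    next
      case (Cons a q)
      show ?thesis
        using that[OF lazy_zombie_move_first_arc] closer[of a q s] p True assms(2)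
        unfolding Cons by metis
    qed
  next
    case False
    then have gt: "dist_to_set G K u < graph_dist G u s"
      using dist_to_set_le[OF assms(2), of G u] by simp
    then have "c \<noteq> s" using c by auto
    then have "c \<rightarrow> s" using assms c(1) by (auto simp: clique_def)
    then obtain e where e: "e \<in> arcs G" "tail G e = c" "head G e = s" by auto
    obtain p where p: "awalk u p c" "length p = graph_dist G u c"
      using graph_dist_awalk[OF reach[OF c(1)]] by blast
    have "awalk c [e] s" using e by (auto intro: arc_implies_awalk)
    then have walk: "awalk u (p @ [e]) s" using p(1) by (rule awalk_appendI[rotated])
    \<comment> \<open>The walk through \<open>c\<close> has one arc more than the distance to
      \<open>K\<close>, and by \<open>gt\<close> the vertex \<open>s\<close> is no nearer than that,
      so the walk is shortest.\<close>
    have len: "length (p @ [e]) = graph_dist G u s"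
      using graph_dist_le[OF walk] gt p(2) c(2) by simp
    show ?thesis
    \<comment> \<open>If \<open>p\<close> is empty, the zombie stands on \<open>c\<close> and
      captures along \<open>e\<close>; otherwise the first arc towards \<open>s\<close> also leads
      towards \<open>c\<close>.\<close>
    proof (cases p)
      case Nil
      show ?thesis
        using that[OF lazy_zombie_move_first_arc[of u e "[]" s]] walk len e unfolding Nil by simp
    next
      case (Cons a q)
      show ?thesis
        using that[OF lazy_zombie_move_first_arc[of u a "q @ [e]" s]] walk len
          closer[of a q c] p c unfolding Cons by simp
    qed
  qed
qed

lemma clique_cover_exists:
  assumes "finite S" "S \<subseteq> verts G"
  obtains P where "finite P" "card P = clique_cover_number (G \<restriction> S)" "\<Union>P = S"
    "\<And>K. K \<in> P \<Longrightarrow> clique G K"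
proof -
  \<comment> \<open>The singletons form a cover, so \<open>LEAST\<close> ranges over a nonempty set
    and its value is attained.\<close>
  let ?P = "(\<lambda>x. {x}) ` S"
  have "finite ?P \<and> card ?P = card ?P \<and> (\<forall>K\<in>?P. clique (G \<restriction> S) K) \<and> \<Union>?P = verts (G \<restriction> S)"
    using assms by (auto simp: clique_def)
  then have "\<exists>k P. finite P \<and> card P = k \<and> (\<forall>K\<in>P. clique (G \<restriction> S) K) \<and> \<Union>P = verts (G \<restriction> S)"
    by blast
  then have "\<exists>P. finite P \<and> card P = clique_cover_number (G \<restriction> S) \<and>
      (\<forall>K\<in>P. clique (G \<restriction> S) K) \<and> \<Union>P = verts (G \<restriction> S)"
    unfolding clique_cover_number_def by (rule LeastI_ex)
  then obtain P where P: "finite P" "card P = clique_cover_number (G \<restriction> S)"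
    "\<forall>K\<in>P. clique (G \<restriction> S) K" "\<Union>P = S" by auto
  moreover have "clique G K" if "K \<in> P" for K
    using P(3) that assms(2) unfolding clique_def
    by (fastforce dest: dominates_induce_subgraphD)
  ultimately show ?thesis using that by blast
qed

section \<open>Winning positions\<close>

text \<open>
  The zombies in \<open>I\<close>, about to move, can capture by one of their next \<open>t\<close> moves. Capture at the end
  of a round need not be treated separately, since a zombie that the survivor runs into may stay.
\<close>

fun zombies_win ::
  "('a,'b) pre_digraph \<Rightarrow> 'a set \<Rightarrow> 'i set \<Rightarrow> nat \<Rightarrow> ('i \<Rightarrow> 'a) \<Rightarrow> 'a \<Rightarrow> bool" where
  "zombies_win G U I 0 z s \<longleftrightarrow> False"
| "zombies_win G U I (Suc t) z s \<longleftrightarrow>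
     (\<exists>z'. (\<forall>i\<in>I. lazy_zombie_move G s (z i) (z' i)) \<and>
        ((\<exists>i\<in>I. z' i = s) \<or>
         (\<forall>s'\<in>U. s' = s \<or> s \<rightarrow>\<^bsub>G\<^esub> s' \<longrightarrow> zombies_win G U I t z' s')))"

lemma zombies_win_capture:
  assumes "\<forall>i\<in>I. lazy_zombie_move G s (z i) (z' i)" "i \<in> I" "z' i = s"
  shows "zombies_win G U I (Suc t) z s"
  unfolding zombies_win.simps using assms by blast

lemma zombies_win_continue:
  assumes "\<forall>i\<in>I. lazy_zombie_move G s (z i) (z' i)"
    and "\<And>s'. s' \<in> U \<Longrightarrow> s' = s \<or> s \<rightarrow>\<^bsub>G\<^esub> s' \<Longrightarrow> zombies_win G U I t z' s'"
  shows "zombies_win G U I (Suc t) z s"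
  unfolding zombies_win.simps using assms by blast

lemma zombies_win_mono:
  assumes "zombies_win G U I t z s" "t \<le> t'"
  shows "zombies_win G U I t' z s"
  using assms
proof (induction t arbitrary: t' z s)
  case (Suc t)
  then obtain t'' where t'': "t' = Suc t''" "t \<le> t''" by (cases t') auto
  show ?case using Suc.prems(1) Suc.IH[OF _ t''(2)] unfolding t''(1) zombies_win.simps by blast
qed simp

text \<open>A strategy sees only the survivor's positions. It recomputes from them the zombies'
  positions and the number of moves left, then makes a move fixed in advance by choice.\<close>

lemma lazy_zombies_capture_if_zombies_win:
  assumes win: "\<And>s. s \<in> U \<Longrightarrow> zombies_win G U {..<k} t z0 s"
  shows "lazy_zombies_capture G U k z0 t"
proof -
  \<comment> \<open>Moves must be legal in every round, even from positions that are not winning;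
    there, standing still shows that a legal choice exists.\<close>
  define good where "good m z s z' \<longleftrightarrow> (\<forall>i<k. lazy_zombie_move G s (z i) (z' i)) \<and>
      (zombies_win G U {..<k} m z s \<longrightarrow> (\<exists>i<k. z' i = s) \<or>
        (\<forall>s'\<in>U. s' = s \<or> s \<rightarrow>\<^bsub>G\<^esub> s' \<longrightarrow> zombies_win G U {..<k} (m - 1) z' s'))"
    for m z s z'
  define pick where "pick m z s = (SOME z'. good m z s z')" for m z s
  have "\<exists>z'. good m z s z'" for m z s
  proof (cases "zombies_win G U {..<k} m z s")
    case True
    then obtain n where "m = Suc n" by (cases m) auto
    then show ?thesis using True unfolding good_def by fastforce
  next
    case False
    then show ?thesis unfolding good_def by (intro exI[of _ z]) (simp add: lazy_zombie_move_def)
  qed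
  then have good: "good m z s (pick m z s)" for m z s
    unfolding pick_def by (rule someI_ex)
  define st where "st xs = foldl (\<lambda>(m, z) s. (m - 1, pick m z s)) (t, z0) xs" for xs
  define \<sigma> where "\<sigma> xs = snd (st xs)" for xs
  have play: "st (map s [0..<n]) = (t - n, zombie_play z0 \<sigma> s n)" for s n
  proof (induction n)
    case (Suc n)
    have "fst (st (map s [0..<Suc n])) = t - Suc n"
      using Suc by (simp add: st_def)
    then show ?case by (simp add: \<sigma>_def prod_eq_iff)
  qed (simp add: st_def)
  have step: "zombie_play z0 \<sigma> s (Suc n) = pick (t - n) (zombie_play z0 \<sigma> s n) (s n)" for s n
  proof -
    have "st (map s [0..<Suc n]) = (t - n - 1, pick (t - n) (zombie_play z0 \<sigma> s n) (s n))"
      using play[of s n] by (simp add: st_def)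
    then show ?thesis by (simp add: \<sigma>_def)
  qed
  have "captured_within k (zombie_play z0 \<sigma> s) s t"
    if s: "survivor_play G s" "\<And>n. s n \<in> U" for s
  proof (rule ccontr)
    assume free: "\<not> captured_within k (zombie_play z0 \<sigma> s) s t"
    have "zombies_win G U {..<k} (t - n) (zombie_play z0 \<sigma> s n) (s n)" if "n \<le> t" for n
      using that
    proof (induction n)
      case 0
      then show ?case using win s(2) by simp
    next
      case (Suc n)
      \<comment> \<open>A zombie on \<open>s n\<close> after moving in round \<open>n + 1\<close>
        counts by the second disjunct of \<open>captured_within\<close>.\<close>
      have "\<not> (\<exists>i<k. zombie_play z0 \<sigma> s (Suc n) i = s n)"
        using free Suc.prems unfolding captured_within_def by (meson Suc_le_lessD)
      moreover have "s (Suc n) = s n \<or> s n \<rightarrow>\<^bsub>G\<^esub> s (Suc n)"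
        using s(1) by (simp add: survivor_play_def)
      ultimately have "zombies_win G U {..<k} (t - n - 1) (zombie_play z0 \<sigma> s (Suc n)) (s (Suc n))"
        using good[of "t - n" "zombie_play z0 \<sigma> s n" "s n"] Suc s(2)
        unfolding step[symmetric] good_def by (meson Suc_leD)
      then show ?case by simp
    qed
    \<comment> \<open>No position is winning with zero moves left.\<close>
    from this[of t] show False by simp
  qed
  moreover have "\<forall>i<k. lazy_zombie_move G (s n) (zombie_play z0 \<sigma> s n i) (zombie_play z0 \<sigma> s (Suc n) i)"
    for s n
    using good[of "t - n" "zombie_play z0 \<sigma> s n" "s n"] unfolding step[symmetric] good_def by blast
  ultimately show ?thesis unfolding lazy_zombies_capture_def by blast
qed

text \<open>
  The bound \<open>p\<close> is the number of visits to the separator \<open>S\<close> that the survivor can still afford.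
  Each stay in a part costs it at most \<open>T - 1\<close> moves without capture, each visit one more.
\<close>

lemma (in wf_digraph) zombies_win_separator:
  fixes A B :: "'i set" and K :: "'i \<Rightarrow> 'a set" and D :: "'w \<Rightarrow> 'a set"
  assumes conn: "strongly_connected G"
    and A: "finite A" "A \<inter> B = {}"
    and K: "\<And>i. i \<in> A \<Longrightarrow> clique G (K i)" "S \<subseteq> (\<Union>i\<in>A. K i)"
    and U: "U \<subseteq> S \<union> (\<Union>w\<in>N. D w)"
    and sep: "\<And>w s s'. \<lbrakk>w \<in> N; s \<in> D w; s \<rightarrow> s'; s' \<in> U\<rbrakk> \<Longrightarrow> s' \<in> S \<union> D w"
    and T: "1 \<le> T"
    and part: "\<And>w z s. \<lbrakk>w \<in> N; s \<in> D w; \<And>i. i \<in> B \<Longrightarrow> z i \<in> verts G\<rbrakk>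
      \<Longrightarrow> zombies_win G (D w) B T z s"
    and z: "\<And>i. i \<in> A \<union> B \<Longrightarrow> z i \<in> verts G"
    and p: "(\<Sum>i\<in>A. dist_to_set G (K i) (z i)) \<le> p"
    and s: "s \<in> U"
  shows "zombies_win G U (A \<union> B) ((p + 1) * T) z s"
proof -
  let ?\<phi> = "\<lambda>z. \<Sum>i\<in>A. dist_to_set G (K i) (z i)"
  let ?ok = "\<lambda>z. \<forall>i\<in>A\<union>B. z i \<in> verts G"
  \<comment> \<open>Taking \<open>visit\<close> for a single \<open>p\<close> as a hypothesis lets
    this serve twice: with the induction hypothesis inside the proof of \<open>visit\<close>, and
    with \<open>visit\<close> itself at the end.\<close>
  have segment: "zombies_win G U (A \<union> B) (p * T + j) z s"
    if visit: "\<And>z s. \<lbrakk>?ok z; ?\<phi> z \<le> p; s \<in> S\<rbrakk> \<Longrightarrow> zombies_win G U (A \<union> B) (p * T + 1) z s"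
      and w: "w \<in> N" "s \<in> D w" and z: "?ok z" "?\<phi> z \<le> p"
      and win: "zombies_win G (D w) B j z s"
    for p j z s w
    using w z win
  proof (induction j arbitrary: z s)
    case (Suc j)
    obtain z1 where z1: "\<And>i. i \<in> B \<Longrightarrow> lazy_zombie_move G s (z i) (z1 i)"
      "(\<exists>i\<in>B. z1 i = s) \<or>
        (\<forall>s'\<in>D w. s' = s \<or> s \<rightarrow> s' \<longrightarrow> zombies_win G (D w) B j z1 s')"
      using Suc.prems(5) by auto
    \<comment> \<open>The zombies in \<open>A\<close> use their right to stay put, so the potential
      does not change while the survivor is inside a part.\<close>
    let ?z = "\<lambda>i. if i \<in> B then z1 i else z i"
    have B: "zombies_win G (D w) B j z1 s' \<Longrightarrow> zombies_win G (D w) B j ?z s'" for s'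
      by (cases j) auto
    have mv: "\<forall>i\<in>A\<union>B. lazy_zombie_move G s (z i) (?z i)"
      using z1(1) by (simp add: lazy_zombie_move_def)
    have ok: "?ok ?z" using mv Suc.prems(3) lazy_zombie_move_in_verts by blast
    have "?\<phi> ?z = ?\<phi> z" using A(2) by (intro sum.cong) auto
    then have \<phi>: "?\<phi> ?z \<le> p" using Suc.prems(4) by simp
    show ?case
    proof (cases "\<exists>i\<in>B. z1 i = s")
      case True
      then obtain i where "i \<in> B" "z1 i = s" by blast
      then show ?thesis using zombies_win_capture[OF mv, of i] by simp
    next
      case False
      then have next_win: "\<forall>s'\<in>D w. s' = s \<or> s \<rightarrow> s' \<longrightarrow> zombies_win G (D w) B j ?z s'"
        using z1(2) B by blast
      text \<open>The survivor may stay, so the zombies cannot have run out of moves.\<close>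
      then have "j \<noteq> 0" using Suc.prems(2) by (metis zombies_win.simps(1))
      have "zombies_win G U (A \<union> B) (p * T + j) ?z s'"
        if s': "s' \<in> U" "s' = s \<or> s \<rightarrow> s'" for s'
      proof (cases "s' \<in> D w")
        case True
        then show ?thesis using Suc.IH[OF w(1) True ok \<phi>] next_win s'(2) by blast
      next
        case False
        \<comment> \<open>Leaving the part means entering \<open>S\<close>, where
          \<open>p * T + 1\<close> moves are needed; \<open>j \<noteq> 0\<close> provides the extra
          one.\<close>
        then have "s' \<in> S" using sep[OF w(1) Suc.prems(2)] s' Suc.prems(2) by blast
        then show ?thesis
          using visit[OF ok \<phi>] zombies_win_mono \<open>j \<noteq> 0\<close> by (metis add_left_mono less_one not_le)
      qed
      then show ?thesis unfolding add_Suc_right by (rule zombies_win_continue[OF mv])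
    qed
  qed simp
  have visit: "zombies_win G U (A \<union> B) (p * T + 1) z s" if "?ok z" "?\<phi> z \<le> p" "s \<in> S" for p z s
    using that
  proof (induction p arbitrary: z s)
    case (0 z s)
    obtain i where i: "i \<in> A" "s \<in> K i" using K(2) 0(3) by blast
    obtain w where w: "lazy_zombie_move G s (z i) w"
      "w = s \<or> dist_to_set G (K i) w < dist_to_set G (K i) (z i)"
      using clique_pursuit[OF K(1)[OF i(1)] i(2) conn, of "z i"] 0(1) i(1) by blast
    \<comment> \<open>With the potential exhausted the distance cannot drop further, so the pursuing
      move must be a capture.\<close>
    have "dist_to_set G (K i) (z i) = 0" using 0(2) A(1) i(1) by auto
    then have "w = s" using w(2) by simp
    then have "\<forall>j\<in>A\<union>B. lazy_zombie_move G s (z j) ((z(i := s)) j)"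
      using w(1) by (simp add: lazy_zombie_move_def)
    then show ?case unfolding Suc_eq_plus1[symmetric]
      by (rule zombies_win_capture[where i = i]) (use i(1) in auto)
  next
    case (Suc p z s)
    obtain i where i: "i \<in> A" "s \<in> K i" using K(2) Suc.prems(3) by blast
    obtain w where w: "lazy_zombie_move G s (z i) w"
      "w = s \<or> dist_to_set G (K i) w < dist_to_set G (K i) (z i)"
      using clique_pursuit[OF K(1)[OF i(1)] i(2) conn, of "z i"] Suc.prems(1) i(1) by blast
    let ?z = "z(i := w)"
    have mv: "\<forall>j\<in>A\<union>B. lazy_zombie_move G s (z j) (?z j)"
      using w(1) by (simp add: lazy_zombie_move_def)
    have ok: "?ok ?z" using mv Suc.prems(1) lazy_zombie_move_in_verts by blast
    show ?case
    proof (cases "w = s")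
      case True
      then show ?thesis unfolding Suc_eq_plus1[symmetric]
        using zombies_win_capture[OF mv, of i] i(1) by simp
    next
      case False
      then have "?\<phi> ?z < ?\<phi> z"
        using w(2) i(1) A(1) by (intro sum_strict_mono_ex1) auto
      then have \<phi>: "?\<phi> ?z \<le> p" using Suc.prems(2) by simp
      \<comment> \<open>One of the \<open>Suc p * T + 1\<close> moves went into the pursuit. If the
        survivor is again in \<open>S\<close>, then \<open>p * T + 1\<close> moves suffice; in a
        part, \<open>T\<close> for the stay plus \<open>p * T\<close> afterwards are exactly what is
        left.\<close>
      have "zombies_win G U (A \<union> B) (Suc p * T) ?z s'" if s': "s' \<in> U" for s'
      proof (cases "s' \<in> S")
        case True
        have "p * T + 1 \<le> Suc p * T" using T by simp
        with Suc.IH[OF ok \<phi> True] show ?thesis by (rule zombies_win_mono)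
      next
        case False
        then obtain w' where w': "w' \<in> N" "s' \<in> D w'" using U s' by blast
        have "zombies_win G (D w') B T ?z s'" using part[OF w'] ok by blast
        from segment[OF Suc.IH w' ok \<phi> this] show ?thesis by (simp add: add.commute)
      qed
      then show ?thesis unfolding Suc_eq_plus1[symmetric] by (rule zombies_win_continue[OF mv])
    qed
  qed
  have ok: "?ok z" using z by blast
  show ?thesis
  proof (cases "s \<in> S")
    case True
    have "p * T + 1 \<le> (p + 1) * T" using T by simp
    with visit[OF ok p True] show ?thesis by (rule zombies_win_mono)
  next
    case False
    then obtain w where w: "w \<in> N" "s \<in> D w" using U s by blast
    have "zombies_win G (D w) B T z s" using part[OF w] z by blast
    from segment[OF visit w ok p this] show ?thesis by (simp add: add.commute)
  qed
qed

section \<open>Cut decompositions\<close>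

context rooted_tree
begin

lemma subtree_nodes_unfold:
  assumes "v \<in> verts X"
  shows "subtree_nodes X v = insert v (\<Union>w\<in>children X v. subtree_nodes X w)"
proof (intro equalityI subsetI)
  fix x assume "x \<in> subtree_nodes X v"
  then have "v \<rightarrow>\<^sup>* x" by (simp add: subtree_nodes_def)
  then show "x \<in> insert v (\<Union>w\<in>children X v. subtree_nodes X w)"
    by (cases rule: converse_reachable_cases) (auto simp: subtree_nodes_def children_def)
next
  fix x assume "x \<in> insert v (\<Union>w\<in>children X v. subtree_nodes X w)"
  then show "x \<in> subtree_nodes X v"
    using assms unfolding subtree_nodes_def children_def by (blast intro: adj_reachable_trans)
qed

text \<open>The walk from the root to \<open>x\<close> is unique. It can be routed through
  \<open>v\<close> and either child, so the arcs taken after \<open>v\<close> coincide.\<close>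

lemma children_subtrees_disjoint:
  assumes "w \<in> children X v" "w' \<in> children X v"
    and "x \<in> subtree_nodes X w" "x \<in> subtree_nodes X w'"
  shows "w = w'"
proof -
  have v: "v \<in> verts X" using assms(1) by (auto simp: children_def dest: adj_in_verts)
  obtain p where p: "awalk r p v" using unique_awalk[OF v] by blast
  have arc: "\<exists>e q. awalk r (p @ e # q) x \<and> head X e = y"
    if y: "y \<in> children X v" "x \<in> subtree_nodes X y" for y
  proof -
    obtain e where e: "e \<in> arcs X" "tail X e = v" "head X e = y"
      using y(1) by (auto simp: children_def)
    obtain q where "awalk y q x"
      using y(2) by (auto simp: subtree_nodes_def reachable_awalk)
    then have "awalk v (e # q) x" using e by (simp add: awalk_Cons_iff)
    then show ?thesis using awalk_appendI[OF p] e by blast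
  qed
  obtain e q e' q' where e: "awalk r (p @ e # q) x" "head X e = w"
    "awalk r (p @ e' # q') x" "head X e' = w'"
    using arc assms by meson
  have "x \<in> verts X" using e(1) by (rule awalk_last_in_verts)
  then have "p @ e # q = p @ e' # q'" using unique_awalk e by blast
  then show ?thesis using e by simp
qed

lemma finite_children: "finite (children X v)"
  by (rule finite_subset[OF _ finite_verts]) (auto simp: children_def dest: adj_in_verts)

lemma children_in_verts: "w \<in> children X v \<Longrightarrow> w \<in> verts X"
  by (auto simp: children_def dest: adj_in_verts)

lemma subtree_nodes_in_verts: "x \<in> subtree_nodes X v \<Longrightarrow> x \<in> verts X"
  by (auto simp: subtree_nodes_def dest: reachable_in_verts)

text \<open>Supplies the bound \<open>1 \<le> T\<close> that \<open>zombies_win_separator\<close>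
  asks for.\<close>

lemma time_star_pos: "1 \<le> rooted_tree.time_star X G C v"
proof (induction v rule: wf_induct_rule[OF wf_child])
  case (1 v)
  show ?case
  proof (cases "is_leaf X v")
    case True
    then show ?thesis by (simp add: time_star.simps[where G = G and C = C and v = v])
  next
    case False
    then obtain w where w: "w \<in> children X v" by (auto simp: is_leaf_def)
    then have "1 \<le> rooted_tree.time_star X G C w" using 1 by blast
    also have "\<dots> \<le> Max (rooted_tree.time_star X G C ` children X v)"
      using w by (intro Max_ge) (auto simp: finite_children)
    finally show ?thesis using False by (simp add: time_star.simps[where G = G and C = C and v = v])
  qed
qed

end

text \<open>The nodes holding the ends of an edge are comparable. Going down from the node of
  \<open>s\<close> stays below \<open>w\<close>; going up within the subtree of \<open>v\<close>
  either stays below \<open>w\<close> or reaches \<open>v\<close>.\<close>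

lemma cut_decomposition_separates:
  assumes dec: "cut_decomposition G X r C"
    and w: "w \<in> children X v"
    and s: "s \<in> subtree_bags X C w" "s \<rightarrow>\<^bsub>G\<^esub> s'" "s' \<in> subtree_bags X C v"
  shows "s' \<in> C v \<union> subtree_bags X C w"
proof -
  interpret rooted_tree X r using dec by (simp add: cut_decomposition_def)
  have C: "C x \<subseteq> verts G" if "x \<in> verts X" for x
    using dec that by (simp add: cut_decomposition_def)
  \<comment> \<open>Bags are disjoint, so the nodes given by the edge condition are the ones found
    by membership in \<open>subtree_bags\<close>.\<close>
  have same: "x = y" if "u \<in> C x" "u \<in> C y" "x \<in> verts X" "y \<in> verts X" for u x y
  proof -
    have "\<exists>!x. x \<in> verts X \<and> u \<in> C x"
      using dec that C[OF that(3)] unfolding cut_decomposition_def by blast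
    then show ?thesis using that by blast
  qed
  have v: "v \<in> verts X" using w by (auto simp: children_def dest: adj_in_verts)
  obtain x y where x: "x \<in> subtree_nodes X w" "s \<in> C x"
    and y: "y \<in> subtree_nodes X v" "s' \<in> C y"
    using s unfolding subtree_bags_def by blast
  note xy = subtree_nodes_in_verts[OF x(1)] subtree_nodes_in_verts[OF y(1)]
  have "\<exists>x\<in>verts X. \<exists>y\<in>verts X. x \<rightarrow>\<^sup>*\<^bsub>X\<^esub> y \<and> (s \<in> C x \<and> s' \<in> C y \<or> s' \<in> C x \<and> s \<in> C y)"
    using dec s(2) unfolding cut_decomposition_def by blast
  then have "x \<rightarrow>\<^sup>*\<^bsub>X\<^esub> y \<or> y \<rightarrow>\<^sup>*\<^bsub>X\<^esub> x" using same x(2) y(2) xy by metis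
  then show ?thesis
  proof
    assume "x \<rightarrow>\<^sup>*\<^bsub>X\<^esub> y"
    then have "y \<in> subtree_nodes X w"
      using x(1) unfolding subtree_nodes_def by (auto intro: reachable_trans)
    then show ?thesis using y(2) unfolding subtree_bags_def by blast
  next
    assume yx: "y \<rightarrow>\<^sup>*\<^bsub>X\<^esub> x"
    show ?thesis
    proof (cases "y = v")
      case False
      then obtain w' where w': "w' \<in> children X v" "y \<in> subtree_nodes X w'"
        using y(1) subtree_nodes_unfold[OF v] by blast
      then have "x \<in> subtree_nodes X w'"
        using yx unfolding subtree_nodes_def by (auto intro: reachable_trans)
      then have "w' = w" using children_subtrees_disjoint w w'(1) x(1) by blast
      then show ?thesis using w'(2) y(2) unfolding subtree_bags_def by blast
    qed (use y(2) in simp)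
  qed
qed

text \<open>Stated for any finite index set of sufficient size, because the recursion hands on an
  arbitrary leftover set \<open>B\<close>, possibly larger than the load of the child
  entered.\<close>

lemma zombies_win_subtree:
  fixes G :: "('a,'b) pre_digraph" and X :: "('n,'e) pre_digraph" and I :: "'i set"
  assumes G: "Digraph.graph G" "Digraph_Component.connected G"
    and dec: "cut_decomposition G X r C"
    and "v \<in> verts X"
    and "finite I" "rooted_tree.load_star X G C v \<le> card I"
    and "\<And>i. i \<in> I \<Longrightarrow> z i \<in> verts G"
    and "s \<in> subtree_bags X C v"
  shows "zombies_win G (subtree_bags X C v) I (rooted_tree.time_star X G C v) z s"
proof -
  interpret G: graph G by fact
  interpret rooted_tree X r using dec by (simp add: cut_decomposition_def)
  have conn: "strongly_connected G"
    using G.symmetric_connected_imp_strongly_connected[OF G.sym_arcs G(2)] .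
  show ?thesis using assms(4-8)
  proof (induction v arbitrary: I z s rule: wf_induct_rule[OF wf_child])
    case (1 v I z s)
    let ?\<theta> = "clique_cover_number (G \<restriction> C v)"
    have Cv: "C v \<subseteq> verts G" using dec 1(2) by (simp add: cut_decomposition_def)
    then have "finite (C v)" by (rule finite_subset) simp
    then obtain P where P: "finite P" "card P = ?\<theta>" "\<Union>P = C v" "\<And>K. K \<in> P \<Longrightarrow> clique G K"
      using clique_cover_exists[OF _ Cv] by metis
    have load: "?\<theta> + (if is_leaf X v then 0 else Max (rooted_tree.load_star X G C ` children X v)) \<le> card I"
      using 1(4) by (simp add: load_star.simps[where G = G and C = C and v = v] split: if_splits)
    then have "?\<theta> \<le> card I" by simp
    then obtain A where A: "A \<subseteq> I" "card A = ?\<theta>" "finite A"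
      by (rule obtain_subset_with_card_n)
    define B where "B = I - A"
    have I: "I = A \<union> B" "A \<inter> B = {}" "finite B" using A 1(3) by (auto simp: B_def)
    obtain K where K: "bij_betw K A P"
      using finite_same_card_bij[OF A(3) P(1)] A(2) P(2) by auto
    have KP: "K i \<in> P" if "i \<in> A" for i using K that by (auto simp: bij_betw_def)
    \<comment> \<open>The value 1 at a leaf gives leaves and inner nodes the same product formula
      for \<open>time_star\<close>.\<close>
    define T where "T = (if is_leaf X v then 1 else Max (rooted_tree.time_star X G C ` children X v))"
    have time: "rooted_tree.time_star X G C v = (?\<theta> * graph_diameter G + 1) * T"
      by (simp add: time_star.simps[where G = G and C = C and v = v] T_def)
    have bags: "subtree_bags X C v = C v \<union> (\<Union>w\<in>children X v. subtree_bags X C w)"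
      using subtree_nodes_unfold[OF 1(2)] by (simp add: subtree_bags_def)
    have childT: "rooted_tree.time_star X G C w \<le> T" if "w \<in> children X v" for w
      using that by (auto simp: T_def is_leaf_def finite_children)
    have T: "1 \<le> T"
    proof (cases "is_leaf X v")
      case False
      then obtain w where "w \<in> children X v" by (auto simp: is_leaf_def)
      from order_trans[OF time_star_pos childT[OF this]] show ?thesis .
    qed (simp add: T_def)
    \<comment> \<open>The survivor chooses the child, so \<open>B\<close> must suffice for the
      heaviest child and \<open>T\<close> for the slowest.\<close>
    have part: "zombies_win G (subtree_bags X C w) B T z s"
      if w: "w \<in> children X v" "s \<in> subtree_bags X C w" and z: "\<And>i. i \<in> B \<Longrightarrow> z i \<in> verts G"
      for w z s
    proof -
      have "rooted_tree.load_star X G C w \<le> Max (rooted_tree.load_star X G C ` children X v)"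
        using w(1) by (intro Max_ge) (auto simp: finite_children)
      moreover have "card B = card I - ?\<theta>" using A by (simp add: B_def card_Diff_subset)
      ultimately have "rooted_tree.load_star X G C w \<le> card B"
        using load w(1) by (auto simp: is_leaf_def split: if_splits)
      then have "zombies_win G (subtree_bags X C w) B (rooted_tree.time_star X G C w) z s"
        using w z by (intro 1(1) I(3) children_in_verts[OF w(1)]) simp_all
      then show ?thesis using childT[OF w(1)] by (rule zombies_win_mono)
    qed
    \<comment> \<open>Each zombie in \<open>A\<close> starts within the diameter of its clique,
      which bounds the initial potential and explains the factor
      \<open>?\<theta> * graph_diameter G + 1\<close>.\<close>
    have "(\<Sum>i\<in>A. dist_to_set G (K i) (z i)) \<le> (\<Sum>i\<in>A. graph_diameter G)"
    proof (intro sum_mono G.dist_to_set_le_diameter)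
      fix i assume "i \<in> A"
      then show "K i \<subseteq> verts G" "z i \<in> verts G"
        using KP P(3) Cv 1(5) A(1) by blast+
    qed
    then have \<phi>: "(\<Sum>i\<in>A. dist_to_set G (K i) (z i)) \<le> ?\<theta> * graph_diameter G"
      using A(2) by simp
    have cover: "C v \<subseteq> (\<Union>i\<in>A. K i)" using K P(3) by (auto simp: bij_betw_def)
    show ?case
      unfolding time unfolding I(1)
    proof (rule G.zombies_win_separator[OF conn A(3) I(2) _ cover _ _ T _ _ \<phi>])
      show "clique G (K i)" if "i \<in> A" for i using that KP P(4) by blast
      show "subtree_bags X C v \<subseteq> C v \<union> (\<Union>w\<in>children X v. subtree_bags X C w)"
        using bags by blast
      show "s' \<in> C v \<union> subtree_bags X C w"
        if "w \<in> children X v" "s \<in> subtree_bags X C w" "s \<rightarrow>\<^bsub>G\<^esub> s'" "s' \<in> subtree_bags X C v"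
        for w s s'
        using cut_decomposition_separates[OF dec that] .
      show "z i \<in> verts G" if "i \<in> A \<union> B" for i using that 1(5) I(1) by blast
    qed (fact part 1(6))+
  qed
qed

theorem theorem9:
  fixes G :: "('a,'b) pre_digraph" and X :: "('n,'e) pre_digraph"
    and r v :: 'n and C :: "'n \<Rightarrow> 'a set" and z0 :: "nat \<Rightarrow> 'a"
  assumes "Digraph.graph G"
    and "Digraph_Component.connected G"
    and "cut_decomposition G X r C"
    and "v \<in> verts X"
    and "\<forall>i < rooted_tree.load_star X G C v. z0 i \<in> verts G"
  shows "lazy_zombies_capture G (subtree_bags X C v)
           (rooted_tree.load_star X G C v) z0 (rooted_tree.time_star X G C v)"
proof (rule lazy_zombies_capture_if_zombies_win)
  fix s assume "s \<in> subtree_bags X C v"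
  with assms show "zombies_win G (subtree_bags X C v) {..<rooted_tree.load_star X G C v}
      (rooted_tree.time_star X G C v) z0 s"
    by (intro zombies_win_subtree[OF assms(1-4)]) simp_all
qed

end
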